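(* There exist a constant $C$ and an infinite collection of graphs $\Gamma$ such that $N^{0}(CL\text{-}IS_{\Gamma}) \geq \frac{6}{5}\log_2 |V(\Gamma)| - C$ for every $\Gamma$ in the collection.
   Context: For a graph $\Gamma$, the clique versus independent set problem $CL\text{-}IS_\Gamma$ is the Boolean function $f(C,I)=|C\cap I|\in\{0,1\}$, where $C$ ranges over all cliques of $\Gamma$ (Alice's input) and $I$ over all independent sets of $\Gamma$ (Bob's input); its communication matrix $M$ has rows indexed by cliques, columns by independent sets, and $M_{C,I}=f(C,I)$. A combinatorial rectangle is a set $A\times B$ of entries with $A$ a set of rows and $B$ a set of columns; it is $0$-monochromatic if all its entries are $0$. $C^0(CL\text{-}IS_\Gamma)$ is the minimum number of $0$-monochromatic rectangles whose union covers all $0$-entries of $M$, and the nondeterministic communication complexity is $N^0(CL\text{-}IS_\Gamma)=\lceil \log_2 C^0(CL\text{-}IS_\Gamma)\rceil$. *)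

theory Defs
  imports Complex_Main "HOL-Library.Ramsey"
begin

text \<open>
  A graph is a pair of a vertex set and a set of two-element edges.  Cliques and independent
  sets are those of \<^theory>\<open>HOL-Library.Ramsey\<close>; the empty set is both.
\<close>

type_synonym 'a graph = "'a set \<times> 'a set set"

definition simple_graph :: "'a graph \<Rightarrow> bool" where
  "simple_graph = (\<lambda>(V, E). finite V \<and> V \<noteq> {} \<and> E \<subseteq> [V]\<^bsup>2\<^esup>)"

definition graph_isomorphic :: "'a graph \<Rightarrow> 'b graph \<Rightarrow> bool" where
  "graph_isomorphic = (\<lambda>(V, E) (W, F).
     \<exists>\<phi>. bij_betw \<phi> V W \<and> (\<forall>u\<in>V. \<forall>v\<in>V. {u, v} \<in> E \<longleftrightarrow> {\<phi> u, \<phi> v} \<in> F))"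

definition cliques :: "'a graph \<Rightarrow> 'a set set" where
  "cliques = (\<lambda>(V, E). {C. C \<subseteq> V \<and> clique C E})"

definition independent_sets :: "'a graph \<Rightarrow> 'a set set" where
  "independent_sets = (\<lambda>(V, E). {I. I \<subseteq> V \<and> indep I E})"

text \<open>
  A communication problem is given by its rows \<open>X\<close>, its columns \<open>Y\<close> and the matrix
  \<open>M\<close>, of which only the entries in \<open>X \<times> Y\<close> matter.
\<close>

definition rectangles :: "'r set \<Rightarrow> 'c set \<Rightarrow> ('r \<times> 'c) set set" where
  "rectangles X Y = {A \<times> B | A B. A \<subseteq> X \<and> B \<subseteq> Y}"

definition zero_monochromatic :: "('r \<Rightarrow> 'c \<Rightarrow> nat) \<Rightarrow> ('r \<times> 'c) set \<Rightarrow> bool" where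
  "zero_monochromatic M R \<longleftrightarrow> (\<forall>(x, y)\<in>R. M x y = 0)"

definition zero_cover ::
  "'r set \<Rightarrow> 'c set \<Rightarrow> ('r \<Rightarrow> 'c \<Rightarrow> nat) \<Rightarrow> ('r \<times> 'c) set set \<Rightarrow> bool" where
  "zero_cover X Y M \<R> \<longleftrightarrow>
     \<R> \<subseteq> rectangles X Y \<and> (\<forall>R\<in>\<R>. zero_monochromatic M R) \<and>
     {(x, y). x \<in> X \<and> y \<in> Y \<and> M x y = 0} \<subseteq> \<Union>\<R>"

text \<open>The minimum exists whenever \<open>X\<close> and \<open>Y\<close> are finite.\<close>

definition zero_cover_number :: "'r set \<Rightarrow> 'c set \<Rightarrow> ('r \<Rightarrow> 'c \<Rightarrow> nat) \<Rightarrow> nat" where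
  "zero_cover_number X Y M = (LEAST k. \<exists>\<R>. finite \<R> \<and> card \<R> = k \<and> zero_cover X Y M \<R>)"

definition nondet_complexity0 :: "'r set \<Rightarrow> 'c set \<Rightarrow> ('r \<Rightarrow> 'c \<Rightarrow> nat) \<Rightarrow> int" where
  "nondet_complexity0 X Y M = \<lceil>log 2 (real (zero_cover_number X Y M))\<rceil>"

definition CL_IS :: "'a set \<Rightarrow> 'a set \<Rightarrow> nat" where
  "CL_IS C I = card (C \<inter> I)"

definition N0_CL_IS :: "'a graph \<Rightarrow> int" where
  "N0_CL_IS \<Gamma> = nondet_complexity0 (cliques \<Gamma>) (independent_sets \<Gamma>) CL_IS"

end

theory Submission
  imports Defs "HOL-Library.Nat_Bijection"
begin

text \<open>
  Suppose cliques \<open>C x\<close> and independent sets \<open>I x\<close>, indexed by \<open>x \<in> X\<close>, satisfy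
  \<open>C x \<inter> I x = {}\<close>, while for \<open>x \<noteq> y\<close> one of \<open>C x \<inter> I y\<close>, \<open>C y \<inter> I x\<close> is nonempty.
  Then the entries \<open>(C x, I x)\<close> form a fooling set, so a cover of the zeros needs at least
  \<open>card X\<close> rectangles.  Such a graph arises from arbitrary families of sets with
  \<open>card (C x \<inter> I y) \<le> 1\<close>, by joining two vertices whenever they lie in a common \<open>C x\<close>.
  Equivalently, one needs disjoint rectangles in \<open>X \<times> X\<close> (one for each vertex \<open>p\<close>, namely
  \<open>{(x, y). p \<in> C x \<and> p \<in> I y}\<close>) that avoid the diagonal and meet every pair in at least one
  of its two orders.  For \<open>X = {0..<n}\<^sup>3\<close> the ordered pairs \<open>((a, b, c), (a', b', c'))\<close> with
  \<open>b' < b \<and> c' = c\<close>, with \<open>a \<le> a' \<and> c \<noteq> c'\<close>, or with \<open>a' < a \<and> b \<le> b'\<close> form three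
  disjoint classes, which together have this property, and each splits into \<open>n\<^sup>2\<close> rectangles
  according to the two coordinates of the first point that occur in it.  Hence \<open>3n\<^sup>2\<close> vertices
  force \<open>n\<^sup>3\<close> rectangles, and the exponent \<open>3/2\<close> exceeds \<open>6/5\<close>.
\<close>

definition joined_graph :: "'a set \<Rightarrow> 'i set \<Rightarrow> ('i \<Rightarrow> 'a set) \<Rightarrow> 'a graph" where
  "joined_graph V X C = (V, {{p, q} | p q. p \<noteq> q \<and> (\<exists>x\<in>X. {p, q} \<subseteq> C x)})"

lemma simple_joined_graph:
  assumes "finite V" "V \<noteq> {}" "\<And>x. x \<in> X \<Longrightarrow> C x \<subseteq> V"
  shows "simple_graph (joined_graph V X C)"
proof -
  have "{p, q} \<in> [V]\<^bsup>2\<^esup>" if "p \<noteq> q" "x \<in> X" "{p, q} \<subseteq> C x" for p q x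
    using that assms(3)[of x] by (auto simp: nsets_def)
  then show ?thesis
    using assms(1,2) unfolding simple_graph_def joined_graph_def by auto
qed

lemma clique_joined_graph:
  assumes "x \<in> X" "C x \<subseteq> V"
  shows "C x \<in> cliques (joined_graph V X C)"
  using assms unfolding cliques_def joined_graph_def clique_def by auto

text \<open>An edge inside \<open>J\<close> would have both ends in one \<open>C x\<close>, giving
  two distinct points of \<open>C x \<inter> J\<close>.\<close>

lemma independent_joined_graph:
  assumes "J \<subseteq> V" "\<And>x p q. x \<in> X \<Longrightarrow> p \<in> C x \<inter> J \<Longrightarrow> q \<in> C x \<inter> J \<Longrightarrow> p = q"
  shows "J \<in> independent_sets (joined_graph V X C)"
proof -
  have "{p, q} \<noteq> {p', q'}"
    if "p \<in> J" "q \<in> J" "p' \<noteq> q'" "x \<in> X" "{p', q'} \<subseteq> C x" for p q p' q' x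
    using that assms(2)[of x p' q'] by (auto simp: doubleton_eq_iff)
  then show ?thesis
    using assms(1) unfolding independent_sets_def joined_graph_def indep_def by auto
qed

section \<open>Fooling sets and covers by rectangles\<close>

lemma zero_cover_exists:
  assumes "finite X" "finite Y"
  shows "\<exists>\<R>. finite \<R> \<and> zero_cover X Y M \<R>"
proof -
  let ?Z = "{(x, y). x \<in> X \<and> y \<in> Y \<and> M x y = 0}"
  let ?\<R> = "(\<lambda>(x, y). {x} \<times> {y}) ` ?Z"
  have "finite ?Z"
    by (rule finite_subset[of _ "X \<times> Y"]) (use assms in auto)
  then have "finite ?\<R>" by simp
  moreover have "{x} \<times> {y} \<in> rectangles X Y" if "x \<in> X" "y \<in> Y" for x y
    unfolding rectangles_def using that by (intro CollectI exI[of _ "{x}"] exI[of _ "{y}"]) simp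
  then have "zero_cover X Y M ?\<R>"
    unfolding zero_cover_def zero_monochromatic_def by auto
  ultimately show ?thesis by blast
qed

text \<open>Two diagonal entries in one rectangle would force both crossed entries into it, yet one
  of these is nonzero.\<close>

lemma fooling_set_card_le_zero_cover:
  assumes "finite \<R>" "zero_cover X Y M \<R>"
    and diag: "\<And>s. s \<in> S \<Longrightarrow> f s \<in> X \<and> g s \<in> Y \<and> M (f s) (g s) = 0"
    and off: "\<And>s t. s \<in> S \<Longrightarrow> t \<in> S \<Longrightarrow> s \<noteq> t \<Longrightarrow> M (f s) (g t) \<noteq> 0 \<or> M (f t) (g s) \<noteq> 0"
  shows "card S \<le> card \<R>"
proof -
  have "(f s, g s) \<in> \<Union>\<R>" if "s \<in> S" for s
    using assms(2) diag[OF that] unfolding zero_cover_def by fast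
  then have "\<forall>s\<in>S. \<exists>R\<in>\<R>. (f s, g s) \<in> R"
    by blast
  then obtain h where h: "\<And>s. s \<in> S \<Longrightarrow> h s \<in> \<R> \<and> (f s, g s) \<in> h s"
    by metis
  have "inj_on h S"
  proof (rule inj_onI, rule ccontr)
    fix s t assume st: "s \<in> S" "t \<in> S" "h s = h t" "s \<noteq> t"
    have zero: "\<forall>(x, y)\<in>h s. M x y = 0" and "h s \<in> rectangles X Y"
      using assms(2) h[OF st(1)] unfolding zero_cover_def zero_monochromatic_def by auto
    then obtain A B where AB: "h s = A \<times> B"
      unfolding rectangles_def by auto
    then have "(f s, g t) \<in> h s" "(f t, g s) \<in> h s"
      using h[OF st(1)] h[OF st(2)] st(3) by auto
    then show False
      using zero off[OF st(1,2,4)] by auto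
  qed
  then show ?thesis
    using h assms(1) by (metis card_inj_on_le image_subsetI)
qed

lemma fooling_set_card_le_zero_cover_number:
  assumes "finite X" "finite Y"
    and "\<And>s. s \<in> S \<Longrightarrow> f s \<in> X \<and> g s \<in> Y \<and> M (f s) (g s) = 0"
    and "\<And>s t. s \<in> S \<Longrightarrow> t \<in> S \<Longrightarrow> s \<noteq> t \<Longrightarrow> M (f s) (g t) \<noteq> 0 \<or> M (f t) (g s) \<noteq> 0"
  shows "card S \<le> zero_cover_number X Y M"
proof -
  let ?P = "\<lambda>k. \<exists>\<R>. finite \<R> \<and> card \<R> = k \<and> zero_cover X Y M \<R>"
  \<comment> \<open>Some cover exists, so the \<open>LEAST\<close> is attained rather than
    unspecified.\<close>
  have "\<exists>k. ?P k"
    using zero_cover_exists[OF assms(1,2)] by blast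
  then have "?P (zero_cover_number X Y M)"
    unfolding zero_cover_number_def by (rule LeastI_ex)
  then obtain \<R> where "finite \<R>" "card \<R> = zero_cover_number X Y M" "zero_cover X Y M \<R>"
    by blast
  then show ?thesis
    using fooling_set_card_le_zero_cover[of \<R> X Y M S f g] assms(3,4) by simp
qed

lemma log_card_le_N0_CL_IS_joined_graph:
  assumes "finite V" "finite X" "X \<noteq> {}"
    and sub: "\<And>x. x \<in> X \<Longrightarrow> C x \<subseteq> V" "\<And>x. x \<in> X \<Longrightarrow> I x \<subseteq> V"
    and once: "\<And>x y p q. x \<in> X \<Longrightarrow> y \<in> X \<Longrightarrow> p \<in> C x \<inter> I y \<Longrightarrow> q \<in> C x \<inter> I y \<Longrightarrow> p = q"
    and diag: "\<And>x. x \<in> X \<Longrightarrow> C x \<inter> I x = {}"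
    and off: "\<And>x y. x \<in> X \<Longrightarrow> y \<in> X \<Longrightarrow> x \<noteq> y \<Longrightarrow> C x \<inter> I y \<noteq> {} \<or> C y \<inter> I x \<noteq> {}"
  shows "log 2 (card X) \<le> N0_CL_IS (joined_graph V X C)"
proof -
  let ?\<Gamma> = "joined_graph V X C"
  have "cliques ?\<Gamma> \<subseteq> Pow V" "independent_sets ?\<Gamma> \<subseteq> Pow V"
    unfolding cliques_def independent_sets_def joined_graph_def by auto
  then have fin: "finite (cliques ?\<Gamma>)" "finite (independent_sets ?\<Gamma>)"
    using assms(1) by (auto intro: finite_subset)
  have "CL_IS (C x) (I y) = 0 \<longleftrightarrow> C x \<inter> I y = {}" if "x \<in> X" for x y
    using that sub(1)[OF that] assms(1) unfolding CL_IS_def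
    by (simp add: finite_subset)
  moreover have "C x \<in> cliques ?\<Gamma>" "I x \<in> independent_sets ?\<Gamma>" if "x \<in> X" for x
    using that sub once by (blast intro: clique_joined_graph independent_joined_graph)+
  ultimately have "card X \<le> zero_cover_number (cliques ?\<Gamma>) (independent_sets ?\<Gamma>) CL_IS"
    using diag off by (intro fooling_set_card_le_zero_cover_number[OF fin, where f = C and g = I]) simp_all
  moreover have "card X > 0"
    using assms(2,3) by (simp add: card_gt_0_iff)
  ultimately have "log 2 (card X)
      \<le> log 2 (zero_cover_number (cliques ?\<Gamma>) (independent_sets ?\<Gamma>) CL_IS)"
    by simp
  then show ?thesis
    unfolding N0_CL_IS_def nondet_complexity0_def by linarith
qed

section \<open>The construction on the cube\<close>

definition vertex_code :: "nat \<Rightarrow> nat \<Rightarrow> nat \<Rightarrow> nat" where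
  "vertex_code i u v = prod_encode (i, prod_encode (u, v))"

lemma vertex_code_eq_iff [simp]:
  "vertex_code i u v = vertex_code j u' v' \<longleftrightarrow> i = j \<and> u = u' \<and> v = v'"
  by (simp add: vertex_code_def)

definition code_vertices :: "nat \<Rightarrow> nat set" where
  "code_vertices n = (\<lambda>(i, u, v). vertex_code i u v) ` ({..<3} \<times> {..<n} \<times> {..<n})"

lemma finite_code_vertices [simp]: "finite (code_vertices n)"
  by (simp add: code_vertices_def)

lemma card_code_vertices: "card (code_vertices n) = 3 * n ^ 2"
proof -
  have "inj_on (\<lambda>(i, u, v). vertex_code i u v) ({..<3} \<times> {..<n} \<times> {..<n})"
    by (auto simp: inj_on_def)
  then show ?thesis
    by (simp add: code_vertices_def card_image card_cartesian_product power2_eq_square)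
qed

lemma vertex_code_in [simp]:
  "vertex_code i u v \<in> code_vertices n \<longleftrightarrow> i < 3 \<and> u < n \<and> v < n"
  by (auto simp: code_vertices_def image_iff)

definition cube :: "nat \<Rightarrow> (nat \<times> nat \<times> nat) set" where
  "cube n = {..<n} \<times> {..<n} \<times> {..<n}"

lemma finite_cube: "finite (cube n)"
  by (simp add: cube_def)

lemma card_cube: "card (cube n) = n ^ 3"
  by (simp add: cube_def card_cartesian_product power3_eq_cube)

text \<open>\<open>vertex_code i u v\<close> names a rectangle of class \<open>i\<close>, with
  \<open>u\<close> and \<open>v\<close> the coordinates fixed in its first point. The clique of a
  point collects the rectangles with that point on the first side, \<open>point_indep\<close> those
  with it on the second.\<close>

definition point_clique :: "nat \<times> nat \<times> nat \<Rightarrow> nat set" where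
  "point_clique = (\<lambda>(a, b, c). {vertex_code 0 b c, vertex_code 1 a c, vertex_code 2 a b})"

definition point_indep :: "nat \<Rightarrow> nat \<times> nat \<times> nat \<Rightarrow> nat set" where
  "point_indep n = (\<lambda>(a, b, c).
     {vertex_code 0 u c | u. b < u \<and> u < n} \<union>
     {vertex_code 1 u v | u v. u \<le> a \<and> v \<noteq> c \<and> v < n} \<union>
     {vertex_code 2 u v | u v. a < u \<and> u < n \<and> v \<le> b})"

definition cube_graph :: "nat \<Rightarrow> nat graph" where
  "cube_graph n = joined_graph (code_vertices n) (cube n) point_clique"

lemma point_clique_subset: "x \<in> cube n \<Longrightarrow> point_clique x \<subseteq> code_vertices n"
  by (auto simp: cube_def point_clique_def)

lemma point_indep_subset: "x \<in> cube n \<Longrightarrow> point_indep n x \<subseteq> code_vertices n"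
  by (auto simp: cube_def point_indep_def)

text \<open>The three conditions are pairwise exclusive, so at most one vertex survives; all three
  fail when the points coincide.\<close>

lemma point_clique_Int_point_indep:
  assumes "(a, b, c) \<in> cube n"
  shows "point_clique (a, b, c) \<inter> point_indep n (a', b', c') =
    (if b' < b \<and> c = c' then {vertex_code 0 b c} else {}) \<union>
    (if a \<le> a' \<and> c \<noteq> c' then {vertex_code 1 a c} else {}) \<union>
    (if a' < a \<and> b \<le> b' then {vertex_code 2 a b} else {})"
proof -
  have "vertex_code 0 b c \<in> point_indep n (a', b', c') \<longleftrightarrow> b' < b \<and> c = c'"
    "vertex_code 1 a c \<in> point_indep n (a', b', c') \<longleftrightarrow> a \<le> a' \<and> c \<noteq> c'"
    "vertex_code 2 a b \<in> point_indep n (a', b', c') \<longleftrightarrow> a' < a \<and> b \<le> b'"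
    using assms by (auto simp: cube_def point_indep_def)
  note members = this
  show ?thesis
    unfolding point_clique_def prod.case Int_insert_left members by simp
qed

lemma simple_cube_graph:
  assumes "n > 0"
  shows "simple_graph (cube_graph n)"
proof -
  have "vertex_code 0 0 0 \<in> code_vertices n"
    using assms by simp
  then have "code_vertices n \<noteq> {}"
    by blast
  then show ?thesis
    unfolding cube_graph_def by (intro simple_joined_graph point_clique_subset) auto
qed

lemma card_fst_cube_graph: "card (fst (cube_graph n)) = 3 * n ^ 2"
  by (simp add: cube_graph_def joined_graph_def card_code_vertices)

lemma N0_CL_IS_cube_graph:
  assumes "n > 0"
  shows "3 * log 2 n \<le> N0_CL_IS (cube_graph n)"
proof -
  have "(0, 0, 0) \<in> cube n"
    using assms by (simp add: cube_def)
  then have "cube n \<noteq> {}"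
    by blast
  then have "log 2 (card (cube n)) \<le> N0_CL_IS (cube_graph n)"
    unfolding cube_graph_def
  proof (intro log_card_le_N0_CL_IS_joined_graph[where I = "point_indep n"])
    fix x y p q
    assume "x \<in> cube n" "p \<in> point_clique x \<inter> point_indep n y"
      "q \<in> point_clique x \<inter> point_indep n y"
    then show "p = q"
      by (cases x; cases y) (auto simp: point_clique_Int_point_indep split: if_splits)
  next
    fix x assume "x \<in> cube n"
    then show "point_clique x \<inter> point_indep n x = {}"
      by (cases x) (simp add: point_clique_Int_point_indep)
  next
    \<comment> \<open>If the third coordinates differ, class 1 applies in one of the orders, since
      the first coordinates are comparable. If they agree, class 0 handles distinct second
      coordinates, and class 2 the case where only the first differ.\<close>
    fix x y assume "x \<in> cube n" "y \<in> cube n" "x \<noteq> y"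
    then show "point_clique x \<inter> point_indep n y \<noteq> {} \<or> point_clique y \<inter> point_indep n x \<noteq> {}"
      by (cases x; cases y) (auto simp: point_clique_Int_point_indep)
  qed (simp_all add: finite_cube point_clique_subset point_indep_subset)
  then show ?thesis
    using assms by (simp add: card_cube log_nat_power)
qed

lemma graph_isomorphic_card_eq:
  assumes "graph_isomorphic \<Gamma> \<Delta>"
  shows "card (fst \<Gamma>) = card (fst \<Delta>)"
  using assms unfolding graph_isomorphic_def by (auto dest: bij_betw_same_card)

theorem theorem4p1:
  shows "\<exists>(C::real) (\<G> :: nat graph set).
    infinite \<G> \<and> (\<forall>\<Gamma>\<in>\<G>. simple_graph \<Gamma>) \<and>
    pairwise (\<lambda>\<Gamma> \<Delta>. \<not> graph_isomorphic \<Gamma> \<Delta>) \<G> \<and>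
    (\<forall>\<Gamma>\<in>\<G>. real_of_int (N0_CL_IS \<Gamma>) \<ge> 6 / 5 * log 2 (real (card (fst \<Gamma>))) - C)"
proof (rule exI[of _ "6 / 5 * log 2 3"], rule exI[of _ "cube_graph ` {0<..}"],
    intro conjI ballI)
  let ?\<G> = "cube_graph ` {0<..}"
  \<comment> \<open>The vertex count determines \<open>n\<close>, which gives both distinctness and
    non-isomorphism.\<close>
  have inj: "m = n" if "card (fst (cube_graph m)) = card (fst (cube_graph n))" for m n
    using that by (simp add: card_fst_cube_graph)
  have "inj_on cube_graph {0<..}"
    by (rule inj_onI, rule inj) simp
  then show "infinite ?\<G>"
    using finite_imageD infinite_Ioi by blast
  show "simple_graph \<Gamma>" if "\<Gamma> \<in> ?\<G>" for \<Gamma>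
    using that simple_cube_graph by auto
  show "pairwise (\<lambda>\<Gamma> \<Delta>. \<not> graph_isomorphic \<Gamma> \<Delta>) ?\<G>"
    unfolding pairwise_def by (auto dest!: graph_isomorphic_card_eq inj)
  show "6 / 5 * log 2 (card (fst \<Gamma>)) - 6 / 5 * log 2 3 \<le> N0_CL_IS \<Gamma>" if "\<Gamma> \<in> ?\<G>" for \<Gamma>
  proof -
    from that obtain n where n: "\<Gamma> = cube_graph n" "n \<in> {0<..}"
      by (rule imageE)
    \<comment> \<open>The constant \<open>6 / 5 * log 2 3\<close> cancels the factor 3, leaving
      \<open>12 / 5 * log 2 n\<close>, at most \<open>3 * log 2 n\<close>.\<close>
    have "log 2 (card (fst \<Gamma>)) = log 2 3 + 2 * log 2 n"
      using n by (simp add: card_fst_cube_graph log_mult log_nat_power)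
    moreover have "0 \<le> log 2 n"
      using n by simp
    moreover have "3 * log 2 n \<le> N0_CL_IS \<Gamma>"
      using n N0_CL_IS_cube_graph[of n] by simp
    ultimately show ?thesis
      by linarith
  qed
qed

end
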